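(* Let $(G,\chi)$ be an edge-colored directed graph and $e$ an edge in $G$. If $\chi(e)\neq\chi(g)$ for every edge $g\ne e$ with $r(g)=r(e)$, then $C^*(G,\chi)$ is isomorphic to $C^*(G_e,\chi_{G_e})$, where $(G_e,\chi_{G_e})$ is the graph obtained from $(G,\chi)$ by reversing the edge $e$.
   Context: An edge-colored directed graph $(G,\chi)$ is a directed graph $G=(V,E,r,s)$ with $V$ and $E$ countable (loops and multiple edges allowed; $r(e)$, $s(e)$ are the range and source of $e$) together with a coloring function $\chi:E\to\mathbb{N}=\{1,2,\dots\}$. Standing assumption: the underlying undirected (multi)graph of $G$ is connected. $C^*(G,\chi)$ is the universal $C^*$-algebra generated by mutually orthogonal projections $\{p_v:v\in V\}$ and partial isometries $\{S_e:e\in E\}$ such that (1) $S_e^*S_e=p_{s(e)}$ for all $e\in E$; (2) for all $v\in V$ and all colors $i$ for which $X=\{e: r(e)=v,\chi(e)=i\}$ is nonempty, $\sum_{e\in F}S_eS_e^*\le p_v$ for every finite $F\subseteq X$, and $\sum_{e\in X}S_eS_e^*=p_v$ if $X$ is finite. The graph $(G_e,\chi_{G_e})$ obtained by reversing $e$: $V(G_e)=V(G)$; $E(G_e)=(E(G)\setminus\{e\})\cup\{\overline e\}$; $r_{G_e}(f)=r(f)$ and $s_{G_e}(f)=s(f)$ for all $f\in E(G)\setminus\{e\}$; $r_{G_e}(\overline e)=s(e)$ and $s_{G_e}(\overline e)=r(e)$; $\chi_{G_e}(f)=\chi(f)+1$ for all $f\in E(G)\setminus\{e\}$; and $\chi_{G_e}(\overline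 e)=1$. *)

theory Defs
  imports
    Complex_Main
    "HOL-Algebra.Module"
    "Graph_Theory.Digraph_Component"
begin

section \<open>C*-algebras\<close>

text \<open>
  A C*-algebra is an algebra with an explicit carrier, so that one can quantify over all C*-algebras
  inside a formula. The structure extends the record of modules; since C*-algebras need not
  be unital, its component \<^const>\<open>one\<close> carries no meaning and occurs in none of the axioms.
\<close>

record 'a cstar = "(complex, 'a) module" +
  adj :: "'a \<Rightarrow> 'a"
  nrm :: "'a \<Rightarrow> real"

locale cstar_algebra = abelian_group A for A :: "('a, 'm) cstar_scheme" (structure) +
  assumes smult_closed: "x \<in> carrier A \<Longrightarrow> c \<odot> x \<in> carrier A"
    and smult_l_distr: "x \<in> carrier A \<Longrightarrow> (c + d) \<odot> x = c \<odot> x \<oplus> d \<odot> x"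
    and smult_r_distr: "\<lbrakk>x \<in> carrier A; y \<in> carrier A\<rbrakk> \<Longrightarrow> c \<odot> (x \<oplus> y) = c \<odot> x \<oplus> c \<odot> y"
    and smult_smult: "x \<in> carrier A \<Longrightarrow> (c * d) \<odot> x = c \<odot> (d \<odot> x)"
    and smult_one: "x \<in> carrier A \<Longrightarrow> 1 \<odot> x = x"
    and mult_closed: "\<lbrakk>x \<in> carrier A; y \<in> carrier A\<rbrakk> \<Longrightarrow> x \<otimes> y \<in> carrier A"
    and mult_assoc: "\<lbrakk>x \<in> carrier A; y \<in> carrier A; z \<in> carrier A\<rbrakk> \<Longrightarrow> (x \<otimes> y) \<otimes> z = x \<otimes> (y \<otimes> z)"
    and mult_l_distr: "\<lbrakk>x \<in> carrier A; y \<in> carrier A; z \<in> carrier A\<rbrakk> \<Longrightarrow> (x \<oplus> y) \<otimes> z = x \<otimes> z \<oplus> y \<otimes> z"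
    and mult_r_distr: "\<lbrakk>x \<in> carrier A; y \<in> carrier A; z \<in> carrier A\<rbrakk> \<Longrightarrow> z \<otimes> (x \<oplus> y) = z \<otimes> x \<oplus> z \<otimes> y"
    and smult_mult_left: "\<lbrakk>x \<in> carrier A; y \<in> carrier A\<rbrakk> \<Longrightarrow> (c \<odot> x) \<otimes> y = c \<odot> (x \<otimes> y)"
    and smult_mult_right: "\<lbrakk>x \<in> carrier A; y \<in> carrier A\<rbrakk> \<Longrightarrow> x \<otimes> (c \<odot> y) = c \<odot> (x \<otimes> y)"
    and adj_closed: "x \<in> carrier A \<Longrightarrow> adj A x \<in> carrier A"
    and adj_adj: "x \<in> carrier A \<Longrightarrow> adj A (adj A x) = x"
    and adj_add: "\<lbrakk>x \<in> carrier A; y \<in> carrier A\<rbrakk> \<Longrightarrow> adj A (x \<oplus> y) = adj A x \<oplus> adj A y"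
    and adj_smult: "x \<in> carrier A \<Longrightarrow> adj A (c \<odot> x) = cnj c \<odot> adj A x"
    and adj_mult: "\<lbrakk>x \<in> carrier A; y \<in> carrier A\<rbrakk> \<Longrightarrow> adj A (x \<otimes> y) = adj A y \<otimes> adj A x"
    and nrm_eq_0: "x \<in> carrier A \<Longrightarrow> nrm A x = 0 \<longleftrightarrow> x = \<zero>"
    and nrm_triangle: "\<lbrakk>x \<in> carrier A; y \<in> carrier A\<rbrakk> \<Longrightarrow> nrm A (x \<oplus> y) \<le> nrm A x + nrm A y"
    and nrm_smult: "x \<in> carrier A \<Longrightarrow> nrm A (c \<odot> x) = cmod c * nrm A x"
    and nrm_mult: "\<lbrakk>x \<in> carrier A; y \<in> carrier A\<rbrakk> \<Longrightarrow> nrm A (x \<otimes> y) \<le> nrm A x * nrm A y"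
    and cstar_identity: "x \<in> carrier A \<Longrightarrow> nrm A (adj A x \<otimes> x) = nrm A x ^ 2"
    and complete: "\<lbrakk>\<And>n. X n \<in> carrier A; \<And>\<epsilon>. \<epsilon> > 0 \<Longrightarrow> \<exists>N. \<forall>m\<ge>N. \<forall>n\<ge>N. nrm A (X m \<ominus> X n) < \<epsilon>\<rbrakk>
      \<Longrightarrow> \<exists>l\<in>carrier A. (\<lambda>n. nrm A (X n \<ominus> l)) \<longlonglongrightarrow> 0"

text \<open>The positive elements of a C*-algebra are those of the form \<open>x* x\<close>.\<close>

definition cstar_le :: "('a, 'm) cstar_scheme \<Rightarrow> 'a \<Rightarrow> 'a \<Rightarrow> bool" where
  "cstar_le A a b \<longleftrightarrow> (\<exists>x\<in>carrier A. b \<ominus>\<^bsub>A\<^esub> a = adj A x \<otimes>\<^bsub>A\<^esub> x)"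

definition is_projection :: "('a, 'm) cstar_scheme \<Rightarrow> 'a \<Rightarrow> bool" where
  "is_projection A p \<longleftrightarrow> p \<in> carrier A \<and> p \<otimes>\<^bsub>A\<^esub> p = p \<and> adj A p = p"

definition is_partial_isometry :: "('a, 'm) cstar_scheme \<Rightarrow> 'a \<Rightarrow> bool" where
  "is_partial_isometry A s \<longleftrightarrow> s \<in> carrier A \<and> s \<otimes>\<^bsub>A\<^esub> adj A s \<otimes>\<^bsub>A\<^esub> s = s"

definition star_homs :: "('a, 'm) cstar_scheme \<Rightarrow> ('b, 'n) cstar_scheme \<Rightarrow> ('a \<Rightarrow> 'b) set" where
  "star_homs A B = {\<phi>.
     (\<forall>x\<in>carrier A. \<phi> x \<in> carrier B) \<and>
     (\<forall>x\<in>carrier A. \<forall>y\<in>carrier A. \<phi> (x \<oplus>\<^bsub>A\<^esub> y) = \<phi> x \<oplus>\<^bsub>B\<^esub> \<phi> y) \<and>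
     (\<forall>c. \<forall>x\<in>carrier A. \<phi> (c \<odot>\<^bsub>A\<^esub> x) = c \<odot>\<^bsub>B\<^esub> \<phi> x) \<and>
     (\<forall>x\<in>carrier A. \<forall>y\<in>carrier A. \<phi> (x \<otimes>\<^bsub>A\<^esub> y) = \<phi> x \<otimes>\<^bsub>B\<^esub> \<phi> y) \<and>
     (\<forall>x\<in>carrier A. \<phi> (adj A x) = adj B (\<phi> x))}"

text \<open>Bijective *-homomorphisms of C*-algebras are automatically isometric.\<close>

definition cstar_isomorphic :: "('a, 'm) cstar_scheme \<Rightarrow> ('b, 'n) cstar_scheme \<Rightarrow> bool" where
  "cstar_isomorphic A B \<longleftrightarrow> (\<exists>\<phi>\<in>star_homs A B. bij_betw \<phi> (carrier A) (carrier B))"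


section \<open>Products and generated subalgebras\<close>

text \<open>
  The C*-algebraic product: uniformly bounded families with pointwise operations and the supremum norm.
  The element 0 is inserted so that the norm is also right for the empty index set.
\<close>

definition cstar_product :: "'i set \<Rightarrow> ('i \<Rightarrow> 'a cstar) \<Rightarrow> ('i \<Rightarrow> 'a) cstar" where
  "cstar_product I B = \<lparr>
     carrier = {f \<in> \<Pi>\<^sub>E i\<in>I. carrier (B i). bdd_above ((\<lambda>i. nrm (B i) (f i)) ` I)},
     monoid.mult = (\<lambda>f g. \<lambda>i\<in>I. f i \<otimes>\<^bsub>B i\<^esub> g i),
     one = (\<lambda>i\<in>I. \<one>\<^bsub>B i\<^esub>),
     zero = (\<lambda>i\<in>I. \<zero>\<^bsub>B i\<^esub>),
     add = (\<lambda>f g. \<lambda>i\<in>I. f i \<oplus>\<^bsub>B i\<^esub> g i),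
     smult = (\<lambda>c f. \<lambda>i\<in>I. c \<odot>\<^bsub>B i\<^esub> f i),
     adj = (\<lambda>f. \<lambda>i\<in>I. adj (B i) (f i)),
     nrm = (\<lambda>f. Sup (insert 0 ((\<lambda>i. nrm (B i) (f i)) ` I)))\<rparr>"

definition closed_star_subalgebra :: "'a set \<Rightarrow> ('a, 'm) cstar_scheme \<Rightarrow> bool" where
  "closed_star_subalgebra C A \<longleftrightarrow> C \<subseteq> carrier A \<and> \<zero>\<^bsub>A\<^esub> \<in> C \<and>
     (\<forall>x\<in>C. \<forall>y\<in>C. x \<oplus>\<^bsub>A\<^esub> y \<in> C) \<and>
     (\<forall>c. \<forall>x\<in>C. c \<odot>\<^bsub>A\<^esub> x \<in> C) \<and>
     (\<forall>x\<in>C. \<forall>y\<in>C. x \<otimes>\<^bsub>A\<^esub> y \<in> C) \<and>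
     (\<forall>x\<in>C. adj A x \<in> C) \<and>
     (\<forall>X. \<forall>l\<in>carrier A. (\<forall>n::nat. X n \<in> C) \<longrightarrow> (\<lambda>n. nrm A (X n \<ominus>\<^bsub>A\<^esub> l)) \<longlonglongrightarrow> 0 \<longrightarrow> l \<in> C)"

definition cstar_generated :: "('a, 'm) cstar_scheme \<Rightarrow> 'a set \<Rightarrow> ('a, 'm) cstar_scheme" where
  "cstar_generated A X = A\<lparr>carrier := \<Inter>{C. closed_star_subalgebra C A \<and> X \<subseteq> C}\<rparr>"


section \<open>Edge-colored directed graphs\<close>

text \<open>The source of an edge is its \<^const>\<open>tail\<close>, its range is its \<^const>\<open>head\<close>.\<close>

locale edge_colored_digraph = wf_digraph G
  for G :: "('v, 'e) pre_digraph" and \<chi> :: "'e \<Rightarrow> nat" +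
  assumes countable_verts: "countable (verts G)"
    and countable_arcs: "countable (arcs G)"
    and connected: "Digraph_Component.connected G"
    and color_pos: "e \<in> arcs G \<Longrightarrow> \<chi> e \<ge> 1"

datatype 'e rev_arc = Old 'e | Bar

definition reverse_arc :: "('v, 'e) pre_digraph \<Rightarrow> 'e \<Rightarrow> ('v, 'e rev_arc) pre_digraph" where
  "reverse_arc G e = \<lparr>
     verts = verts G,
     arcs = Old ` (arcs G - {e}) \<union> {Bar},
     tail = (\<lambda>f. case f of Old g \<Rightarrow> tail G g | Bar \<Rightarrow> head G e),
     head = (\<lambda>f. case f of Old g \<Rightarrow> head G g | Bar \<Rightarrow> tail G e)\<rparr>"

definition reverse_coloring :: "('e \<Rightarrow> nat) \<Rightarrow> 'e rev_arc \<Rightarrow> nat" where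
  "reverse_coloring \<chi> f = (case f of Old g \<Rightarrow> \<chi> g + 1 | Bar \<Rightarrow> 1)"


section \<open>The C*-algebra of an edge-colored directed graph\<close>

definition ck_family ::
  "('v, 'e) pre_digraph \<Rightarrow> ('e \<Rightarrow> nat) \<Rightarrow> ('a, 'm) cstar_scheme \<Rightarrow> ('v \<Rightarrow> 'a) \<Rightarrow> ('e \<Rightarrow> 'a) \<Rightarrow> bool" where
  "ck_family G \<chi> A p S \<longleftrightarrow>
     p \<in> extensional (verts G) \<and> S \<in> extensional (arcs G) \<and>
     (\<forall>v\<in>verts G. is_projection A (p v)) \<and>
     (\<forall>v\<in>verts G. \<forall>w\<in>verts G. v \<noteq> w \<longrightarrow> p v \<otimes>\<^bsub>A\<^esub> p w = \<zero>\<^bsub>A\<^esub>) \<and>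
     (\<forall>e\<in>arcs G. is_partial_isometry A (S e)) \<and>
     (\<forall>e\<in>arcs G. adj A (S e) \<otimes>\<^bsub>A\<^esub> S e = p (tail G e)) \<and>
     (\<forall>v\<in>verts G. \<forall>i. let X = {e \<in> arcs G. head G e = v \<and> \<chi> e = i} in
        X \<noteq> {} \<longrightarrow>
          (\<forall>F. finite F \<and> F \<subseteq> X \<longrightarrow> cstar_le A (\<Oplus>\<^bsub>A\<^esub>e\<in>F. S e \<otimes>\<^bsub>A\<^esub> adj A (S e)) (p v)) \<and>
          (finite X \<longrightarrow> (\<Oplus>\<^bsub>A\<^esub>e\<in>X. S e \<otimes>\<^bsub>A\<^esub> adj A (S e)) = p v))"

text \<open>
  The universal C*-algebra of the relations is the C*-algebra generated by the universal family inside
  the product of all C*-algebras with a family satisfying the relations; evaluation at the index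
  \<open>(B, p, S)\<close> is the canonical *-homomorphism to \<open>B\<close>. Its norm is the supremum of the
  norms over all such families, which is finite as projections and partial isometries have norm at most 1.

  It suffices to let \<open>B\<close> range over the C*-algebras whose carrier is a set of elements of the type
  \<^typ>\<open>nat set\<close>: as there are only countably many vertices and edges, any family generates a separable
  C*-algebra, which has at most continuum many elements and is hence isomorphic to such a \<open>B\<close>.
\<close>

type_synonym ('v, 'e) ck_index = "nat set cstar \<times> ('v \<Rightarrow> nat set) \<times> ('e \<Rightarrow> nat set)"

definition ck_indices :: "('v, 'e) pre_digraph \<Rightarrow> ('e \<Rightarrow> nat) \<Rightarrow> ('v, 'e) ck_index set" where
  "ck_indices G \<chi> = {(B, p, S). cstar_algebra B \<and> ck_family G \<chi> B p S}"

definition univ_proj :: "('v, 'e) pre_digraph \<Rightarrow> ('e \<Rightarrow> nat) \<Rightarrow> 'v \<Rightarrow> ('v, 'e) ck_index \<Rightarrow> nat set" where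
  "univ_proj G \<chi> v = (\<lambda>(B, p, S)\<in>ck_indices G \<chi>. p v)"

definition univ_pisom :: "('v, 'e) pre_digraph \<Rightarrow> ('e \<Rightarrow> nat) \<Rightarrow> 'e \<Rightarrow> ('v, 'e) ck_index \<Rightarrow> nat set" where
  "univ_pisom G \<chi> e = (\<lambda>(B, p, S)\<in>ck_indices G \<chi>. S e)"

definition graph_cstar :: "('v, 'e) pre_digraph \<Rightarrow> ('e \<Rightarrow> nat) \<Rightarrow> (('v, 'e) ck_index \<Rightarrow> nat set) cstar" where
  "graph_cstar G \<chi> = cstar_generated (cstar_product (ck_indices G \<chi>) fst)
     (univ_proj G \<chi> ` verts G \<union> univ_pisom G \<chi> ` arcs G)"

end

theory Submission
  imports Defs "HOL-Algebra.AbelCoset"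
begin

text \<open>
  Since \<open>e\<close> is the only edge of its color with range \<open>r(e)\<close>, the relation at \<open>r(e)\<close> for this color is
  \<open>S\<^sub>e S\<^sub>e* = p\<^bsub>r(e)\<^esub>\<close>. Together with \<open>S\<^sub>e* S\<^sub>e = p\<^bsub>s(e)\<^esub>\<close> it says that \<open>S\<^sub>e\<close> is a partial isometry between
  two vertex projections, and this pair of relations goes over into itself when \<open>S\<^sub>e\<close> is replaced by \<open>S\<^sub>e*\<close>
  and the range and source of \<open>e\<close> are exchanged. The reversed edge again is the only one of its color,
  and the relations of all other color classes do not involve \<open>e\<close>. Hence replacing \<open>S\<^sub>e\<close> by its adjoint
  turns the families for \<open>G\<close> in a C*-algebra into the families for \<open>G\<^sub>e\<close> in the same C*-algebra
  (\<open>ck_family_reversed\<close>), and doing it twice changes nothing (\<open>reversed_index_inverse\<close>).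

  The indices of the two big products, inside which the universal algebras are generated,
  therefore correspond to each other, and reindexing is an isometric *-isomorphism of these products.
  It sends each generator to a generator or to the adjoint of one, in both directions, so it restricts to an
  isomorphism of the generated subalgebras.

  The situation is symmetric in the two graphs. The locale \<open>arc_reversal\<close> has a symmetric set of axioms,
  so that every statement about it holds in both directions.
\<close>

section \<open>Norms in a C*-algebra\<close>

context cstar_algebra
begin

lemma nrm_zero: "nrm A \<zero> = 0"
  using nrm_eq_0[of \<zero>] by simp

lemma smult_zero_left: "x \<in> carrier A \<Longrightarrow> 0 \<odot> x = \<zero>"
  using smult_l_distr[of x 0 0] smult_closed[of x 0] add.l_cancel_one' by force

lemma minus_eq_smult:
  assumes "x \<in> carrier A"
  shows "\<ominus> x = (-1) \<odot> x"
proof -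
  have "(-1) \<odot> x \<oplus> x = \<zero>"
    using smult_l_distr[of x "-1" 1] smult_zero_left smult_one assms by simp
  then show ?thesis
    using assms smult_closed minus_equality by blast
qed

lemma nrm_nonneg:
  assumes "x \<in> carrier A"
  shows "0 \<le> nrm A x"
proof -
  have "nrm A (x \<oplus> (-1) \<odot> x) \<le> nrm A x + nrm A ((-1) \<odot> x)"
    using assms by (intro nrm_triangle smult_closed)
  moreover have "x \<oplus> (-1) \<odot> x = \<zero>"
    using assms by (simp flip: minus_eq_smult add: r_neg)
  ultimately show ?thesis
    using assms by (simp add: nrm_smult nrm_zero)
qed

lemma nrm_le_nrm_adj:
  assumes "x \<in> carrier A"
  shows "nrm A x \<le> nrm A (adj A x)"
proof -
  have "nrm A x ^ 2 \<le> nrm A (adj A x) * nrm A x"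
    using assms cstar_identity[of x] nrm_mult[of "adj A x" x] adj_closed by simp
  then show ?thesis
    using assms nrm_nonneg[of x] nrm_nonneg[of "adj A x"] adj_closed
    by (cases "nrm A x = 0") (auto simp: power2_eq_square)
qed

lemma nrm_adj:
  assumes "x \<in> carrier A"
  shows "nrm A (adj A x) = nrm A x"
  using assms nrm_le_nrm_adj[of x] nrm_le_nrm_adj[of "adj A x"] adj_closed adj_adj by simp

lemma nrm_projection_le_1:
  assumes "is_projection A p"
  shows "nrm A p \<le> 1"
proof -
  have "nrm A p ^ 2 = nrm A p"
    using assms cstar_identity[of p] by (simp add: is_projection_def)
  then show ?thesis
    by (auto simp: power2_eq_square)
qed

lemma zero_mult_zero: "\<zero> \<otimes> \<zero> = \<zero>"
  using smult_mult_left[of \<zero> \<zero> 0] smult_zero_left mult_closed by simp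

lemma adj_zero: "adj A \<zero> = \<zero>"
  using adj_smult[of \<zero> 0] smult_zero_left adj_closed by simp

lemma cstar_le_zero_projection:
  assumes "is_projection A p"
  shows "cstar_le A \<zero> p"
  using assms unfolding cstar_le_def is_projection_def
  by (intro bexI[of _ p]) (auto simp: minus_eq)

lemma cstar_le_refl:
  assumes "x \<in> carrier A"
  shows "cstar_le A x x"
  using assms unfolding cstar_le_def
  by (intro bexI[of _ \<zero>]) (auto simp: minus_eq r_neg adj_zero zero_mult_zero)

lemma is_partial_isometry_adj:
  assumes "is_partial_isometry A s"
  shows "is_partial_isometry A (adj A s)"
proof -
  have s: "s \<in> carrier A" "s \<otimes> adj A s \<otimes> s = s"
    using assms by (auto simp: is_partial_isometry_def)
  have "adj A (s \<otimes> adj A s \<otimes> s) = adj A s \<otimes> s \<otimes> adj A s"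
    using s(1) by (simp add: adj_mult mult_closed adj_closed adj_adj mult_assoc)
  then show ?thesis
    using s by (simp add: is_partial_isometry_def adj_closed adj_adj)
qed

end

section \<open>Reindexing products\<close>

lemma carrier_cstar_product:
  "carrier (cstar_product I B) =
    {f \<in> \<Pi>\<^sub>E i\<in>I. carrier (B i). bdd_above ((\<lambda>i. nrm (B i) (f i)) ` I)}"
  by (simp add: cstar_product_def)

lemma cstar_product_simps:
  "f \<otimes>\<^bsub>cstar_product I B\<^esub> g = (\<lambda>i\<in>I. f i \<otimes>\<^bsub>B i\<^esub> g i)"
  "\<zero>\<^bsub>cstar_product I B\<^esub> = (\<lambda>i\<in>I. \<zero>\<^bsub>B i\<^esub>)"
  "f \<oplus>\<^bsub>cstar_product I B\<^esub> g = (\<lambda>i\<in>I. f i \<oplus>\<^bsub>B i\<^esub> g i)"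
  "c \<odot>\<^bsub>cstar_product I B\<^esub> f = (\<lambda>i\<in>I. c \<odot>\<^bsub>B i\<^esub> f i)"
  "adj (cstar_product I B) f = (\<lambda>i\<in>I. adj (B i) (f i))"
  "nrm (cstar_product I B) f = Sup (insert 0 ((\<lambda>i. nrm (B i) (f i)) ` I))"
  by (simp_all add: cstar_product_def)

lemma mem_carrier_cstar_productI:
  assumes "f \<in> extensional I"
    and "\<And>i. i \<in> I \<Longrightarrow> f i \<in> carrier (B i)"
    and "\<And>i. i \<in> I \<Longrightarrow> nrm (B i) (f i) \<le> K"
  shows "f \<in> carrier (cstar_product I B)"
  using assms by (auto simp: carrier_cstar_product PiE_def intro!: bdd_aboveI2[where M = K])

lemma mem_carrier_cstar_productE:
  assumes "f \<in> carrier (cstar_product I B)"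
  obtains K where "f \<in> extensional I"
    and "\<And>i. i \<in> I \<Longrightarrow> f i \<in> carrier (B i)"
    and "\<And>i. i \<in> I \<Longrightarrow> nrm (B i) (f i) \<le> K"
proof -
  obtain K where "\<And>i. i \<in> I \<Longrightarrow> nrm (B i) (f i) \<le> K"
    using assms by (auto simp: carrier_cstar_product bdd_above_def)
  then show thesis
    using assms that[of K] by (auto simp: carrier_cstar_product PiE_def)
qed

context
  fixes I :: "'i set" and B :: "'i \<Rightarrow> 'a cstar"
  assumes cstar: "\<And>i. i \<in> I \<Longrightarrow> cstar_algebra (B i)"
begin

lemma cstar_product_add_closed:
  assumes "f \<in> carrier (cstar_product I B)" and "g \<in> carrier (cstar_product I B)"
  shows "f \<oplus>\<^bsub>cstar_product I B\<^esub> g \<in> carrier (cstar_product I B)"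
proof -
  obtain K where f: "\<And>i. i \<in> I \<Longrightarrow> f i \<in> carrier (B i)" "\<And>i. i \<in> I \<Longrightarrow> nrm (B i) (f i) \<le> K"
    using assms(1) by (rule mem_carrier_cstar_productE) blast
  obtain L where g: "\<And>i. i \<in> I \<Longrightarrow> g i \<in> carrier (B i)" "\<And>i. i \<in> I \<Longrightarrow> nrm (B i) (g i) \<le> L"
    using assms(2) by (rule mem_carrier_cstar_productE) blast
  show ?thesis
  proof (rule mem_carrier_cstar_productI)
    fix i assume i: "i \<in> I"
    interpret cstar_algebra "B i" by (rule cstar[OF i])
    show "(f \<oplus>\<^bsub>cstar_product I B\<^esub> g) i \<in> carrier (B i)"
      using f g i by (simp add: cstar_product_simps)
    show "nrm (B i) ((f \<oplus>\<^bsub>cstar_product I B\<^esub> g) i) \<le> K + L"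
      using f(2)[OF i] g(2)[OF i] nrm_triangle[OF f(1)[OF i] g(1)[OF i]] i
      by (simp add: cstar_product_simps)
  qed (simp add: cstar_product_simps)
qed

lemma cstar_product_mult_closed:
  assumes "f \<in> carrier (cstar_product I B)" and "g \<in> carrier (cstar_product I B)"
  shows "f \<otimes>\<^bsub>cstar_product I B\<^esub> g \<in> carrier (cstar_product I B)"
proof -
  obtain K where f: "\<And>i. i \<in> I \<Longrightarrow> f i \<in> carrier (B i)" "\<And>i. i \<in> I \<Longrightarrow> nrm (B i) (f i) \<le> K"
    using assms(1) by (rule mem_carrier_cstar_productE) blast
  obtain L where g: "\<And>i. i \<in> I \<Longrightarrow> g i \<in> carrier (B i)" "\<And>i. i \<in> I \<Longrightarrow> nrm (B i) (g i) \<le> L"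
    using assms(2) by (rule mem_carrier_cstar_productE) blast
  show ?thesis
  proof (rule mem_carrier_cstar_productI)
    fix i assume i: "i \<in> I"
    interpret cstar_algebra "B i" by (rule cstar[OF i])
    show "(f \<otimes>\<^bsub>cstar_product I B\<^esub> g) i \<in> carrier (B i)"
      using f g i by (simp add: cstar_product_simps mult_closed)
    have "nrm (B i) (f i) * nrm (B i) (g i) \<le> K * L"
      using f g i nrm_nonneg by (meson mult_mono order_trans)
    then show "nrm (B i) ((f \<otimes>\<^bsub>cstar_product I B\<^esub> g) i) \<le> K * L"
      using nrm_mult[OF f(1)[OF i] g(1)[OF i]] i by (simp add: cstar_product_simps)
  qed (simp add: cstar_product_simps)
qed

lemma cstar_product_smult_closed:
  assumes "f \<in> carrier (cstar_product I B)"
  shows "c \<odot>\<^bsub>cstar_product I B\<^esub> f \<in> carrier (cstar_product I B)"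
proof -
  obtain K where f: "\<And>i. i \<in> I \<Longrightarrow> f i \<in> carrier (B i)" "\<And>i. i \<in> I \<Longrightarrow> nrm (B i) (f i) \<le> K"
    using assms by (rule mem_carrier_cstar_productE) blast
  show ?thesis
  proof (rule mem_carrier_cstar_productI)
    fix i assume i: "i \<in> I"
    interpret cstar_algebra "B i" by (rule cstar[OF i])
    show "(c \<odot>\<^bsub>cstar_product I B\<^esub> f) i \<in> carrier (B i)"
      using f i by (simp add: cstar_product_simps smult_closed)
    show "nrm (B i) ((c \<odot>\<^bsub>cstar_product I B\<^esub> f) i) \<le> cmod c * K"
      using f i by (simp add: cstar_product_simps nrm_smult mult_left_mono)
  qed (simp add: cstar_product_simps)
qed

lemma cstar_product_adj_closed:
  assumes "f \<in> carrier (cstar_product I B)"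
  shows "adj (cstar_product I B) f \<in> carrier (cstar_product I B)"
proof -
  obtain K where f: "\<And>i. i \<in> I \<Longrightarrow> f i \<in> carrier (B i)" "\<And>i. i \<in> I \<Longrightarrow> nrm (B i) (f i) \<le> K"
    using assms by (rule mem_carrier_cstar_productE) blast
  show ?thesis
  proof (rule mem_carrier_cstar_productI)
    fix i assume i: "i \<in> I"
    interpret cstar_algebra "B i" by (rule cstar[OF i])
    show "adj (cstar_product I B) f i \<in> carrier (B i)"
      using f i by (simp add: cstar_product_simps adj_closed)
    show "nrm (B i) (adj (cstar_product I B) f i) \<le> K"
      using f i by (simp add: cstar_product_simps nrm_adj)
  qed (simp add: cstar_product_simps)
qed

lemma cstar_product_zero_closed: "\<zero>\<^bsub>cstar_product I B\<^esub> \<in> carrier (cstar_product I B)"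
proof (rule mem_carrier_cstar_productI[where K = 0])
  fix i assume i: "i \<in> I"
  interpret cstar_algebra "B i" by (rule cstar[OF i])
  show "\<zero>\<^bsub>cstar_product I B\<^esub> i \<in> carrier (B i)"
    using i by (simp add: cstar_product_simps)
  show "nrm (B i) (\<zero>\<^bsub>cstar_product I B\<^esub> i) \<le> 0"
    using i by (simp add: cstar_product_simps nrm_zero)
qed (simp add: cstar_product_simps)

text \<open>
  Differences, and with them the closedness of subalgebras, are defined through a description of the
  additive inverse. Only in a group is it known to be preserved by homomorphisms.
\<close>

lemma abelian_group_cstar_product: "abelian_group (cstar_product I B)"
proof (rule abelian_groupI)
  let ?P = "cstar_product I B"
  show "\<zero>\<^bsub>?P\<^esub> \<in> carrier ?P"
    by (rule cstar_product_zero_closed)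
  show "f \<oplus>\<^bsub>?P\<^esub> g \<in> carrier ?P" if "f \<in> carrier ?P" "g \<in> carrier ?P" for f g
    using that by (rule cstar_product_add_closed)
  have ag: "abelian_group (B i)" if "i \<in> I" for i
    using cstar[OF that] by (simp add: cstar_algebra_def)
  have ac: "f i \<in> carrier (B i)" if "f \<in> carrier ?P" "i \<in> I" for f i
    using that by (auto elim: mem_carrier_cstar_productE)
  show "f \<oplus>\<^bsub>?P\<^esub> g \<oplus>\<^bsub>?P\<^esub> h = f \<oplus>\<^bsub>?P\<^esub> (g \<oplus>\<^bsub>?P\<^esub> h)"
    if "f \<in> carrier ?P" "g \<in> carrier ?P" "h \<in> carrier ?P" for f g h
    using that
    by (auto simp: cstar_product_simps fun_eq_iff restrict_def ac abelian_monoid.a_assoc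
          intro!: abelian_monoid.a_assoc abelian_group.axioms(1) ag)
  show "f \<oplus>\<^bsub>?P\<^esub> g = g \<oplus>\<^bsub>?P\<^esub> f" if "f \<in> carrier ?P" "g \<in> carrier ?P" for f g
    using that
    by (auto simp: cstar_product_simps fun_eq_iff restrict_def ac
          intro!: abelian_monoid.a_comm abelian_group.axioms(1) ag)
  show "\<zero>\<^bsub>?P\<^esub> \<oplus>\<^bsub>?P\<^esub> f = f" if f: "f \<in> carrier ?P" for f
  proof -
    have "f \<in> extensional I"
      using f by (auto elim: mem_carrier_cstar_productE)
    then show ?thesis
      using f ac[OF f] abelian_monoid.l_zero[OF abelian_group.axioms(1)[OF ag]]
      by (auto simp: cstar_product_simps fun_eq_iff extensional_def)
  qed
  show "\<exists>g\<in>carrier ?P. g \<oplus>\<^bsub>?P\<^esub> f = \<zero>\<^bsub>?P\<^esub>" if f: "f \<in> carrier ?P" for f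
  proof (rule bexI)
    show "(-1) \<odot>\<^bsub>?P\<^esub> f \<in> carrier ?P"
      using f by (rule cstar_product_smult_closed)
    have "(-1) \<odot>\<^bsub>B i\<^esub> f i \<oplus>\<^bsub>B i\<^esub> f i = \<zero>\<^bsub>B i\<^esub>" if i: "i \<in> I" for i
    proof -
      interpret cstar_algebra "B i" by (rule cstar[OF i])
      show ?thesis
        using ac[OF f i] by (simp flip: minus_eq_smult add: l_neg)
    qed
    then show "(-1) \<odot>\<^bsub>?P\<^esub> f \<oplus>\<^bsub>?P\<^esub> f = \<zero>\<^bsub>?P\<^esub>"
      by (auto simp: cstar_product_simps fun_eq_iff)
  qed
qed

lemma closed_star_subalgebra_carrier_cstar_product:
  "closed_star_subalgebra (carrier (cstar_product I B)) (cstar_product I B)"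
  by (auto simp: closed_star_subalgebra_def cstar_product_zero_closed cstar_product_add_closed
      cstar_product_smult_closed cstar_product_mult_closed cstar_product_adj_closed)

end

lemma pullback_star_hom:
  assumes "\<sigma> ` I \<subseteq> J" and "\<And>i. i \<in> I \<Longrightarrow> B i = C (\<sigma> i)"
  shows "(\<lambda>f. \<lambda>i\<in>I. f (\<sigma> i)) \<in> star_homs (cstar_product J C) (cstar_product I B)"
proof -
  have "(\<lambda>i\<in>I. f (\<sigma> i)) \<in> carrier (cstar_product I B)" if "f \<in> carrier (cstar_product J C)" for f
  proof -
    obtain K where "\<And>j. j \<in> J \<Longrightarrow> f j \<in> carrier (C j)" "\<And>j. j \<in> J \<Longrightarrow> nrm (C j) (f j) \<le> K"
      using \<open>f \<in> _\<close> by (rule mem_carrier_cstar_productE) blast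
    then show ?thesis
      using assms by (intro mem_carrier_cstar_productI[where K = K]) auto
  qed
  moreover have "\<And>i. i \<in> I \<Longrightarrow> \<sigma> i \<in> J"
    using assms(1) by blast
  ultimately show ?thesis
    using assms(2) by (auto simp: star_homs_def cstar_product_simps fun_eq_iff)
qed

lemma nrm_pullback:
  assumes "\<sigma> ` I = J" and "\<And>i. i \<in> I \<Longrightarrow> B i = C (\<sigma> i)"
  shows "nrm (cstar_product I B) (\<lambda>i\<in>I. f (\<sigma> i)) = nrm (cstar_product J C) f"
proof -
  have "(\<lambda>i. nrm (B i) ((\<lambda>i\<in>I. f (\<sigma> i)) i)) ` I = (\<lambda>j. nrm (C j) (f j)) ` (\<sigma> ` I)"
    using assms(2) by (auto simp: image_image)
  then show ?thesis
    by (simp only: cstar_product_simps assms(1))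
qed

section \<open>Generated subalgebras\<close>

text \<open>
  An isometric *-homomorphism commutes with differences and is therefore continuous, so the preimage of a
  closed *-subalgebra is one.
\<close>

lemma closed_star_subalgebra_vimage:
  assumes "abelian_group A" and "abelian_group B"
    and carrier: "closed_star_subalgebra (carrier A) A"
    and \<phi>: "\<phi> \<in> star_homs A B"
    and isometric: "\<And>x. x \<in> carrier A \<Longrightarrow> nrm B (\<phi> x) = nrm A x"
    and C: "closed_star_subalgebra C B"
  shows "closed_star_subalgebra {x \<in> carrier A. \<phi> x \<in> C} A"
proof -
  interpret A: abelian_group A by fact
  interpret B: abelian_group B by fact
  have hom: "\<phi> x \<in> carrier B" "\<phi> (x \<oplus>\<^bsub>A\<^esub> y) = \<phi> x \<oplus>\<^bsub>B\<^esub> \<phi> y" if "x \<in> carrier A" "y \<in> carrier A" for x y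
    using \<phi> that by (auto simp: star_homs_def)
  interpret \<phi>: abelian_group_hom A B \<phi>
    by (intro abelian_group_homI assms group_hom.intro group_hom_axioms.intro A.a_group B.a_group)
      (auto simp: hom_def hom)
  have minus: "\<phi> (x \<ominus>\<^bsub>A\<^esub> y) = \<phi> x \<ominus>\<^bsub>B\<^esub> \<phi> y" if "x \<in> carrier A" "y \<in> carrier A" for x y
    using that by (simp add: A.minus_eq B.minus_eq)
  have C_closed: "\<zero>\<^bsub>B\<^esub> \<in> C"
    "\<And>x y. \<lbrakk>x \<in> C; y \<in> C\<rbrakk> \<Longrightarrow> x \<oplus>\<^bsub>B\<^esub> y \<in> C"
    "\<And>c x. x \<in> C \<Longrightarrow> c \<odot>\<^bsub>B\<^esub> x \<in> C"
    "\<And>x y. \<lbrakk>x \<in> C; y \<in> C\<rbrakk> \<Longrightarrow> x \<otimes>\<^bsub>B\<^esub> y \<in> C"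
    "\<And>x. x \<in> C \<Longrightarrow> adj B x \<in> C"
    "\<And>X l. \<lbrakk>l \<in> carrier B; \<forall>n::nat. X n \<in> C; (\<lambda>n. nrm B (X n \<ominus>\<^bsub>B\<^esub> l)) \<longlonglongrightarrow> 0\<rbrakk> \<Longrightarrow> l \<in> C"
    using C by (simp_all add: closed_star_subalgebra_def)
  have limit: "\<phi> l \<in> C"
    if l: "l \<in> carrier A" and X: "\<forall>n::nat. X n \<in> carrier A \<and> \<phi> (X n) \<in> C"
      and lim: "(\<lambda>n. nrm A (X n \<ominus>\<^bsub>A\<^esub> l)) \<longlonglongrightarrow> 0" for X l
  proof -
    have "nrm B (\<phi> (X n) \<ominus>\<^bsub>B\<^esub> \<phi> l) = nrm A (X n \<ominus>\<^bsub>A\<^esub> l)" for n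
      using X l by (simp flip: minus add: isometric)
    then have "(\<lambda>n. nrm B (\<phi> (X n) \<ominus>\<^bsub>B\<^esub> \<phi> l)) \<longlonglongrightarrow> 0"
      using lim by simp
    moreover have "\<phi> l \<in> carrier B" "\<forall>n. \<phi> (X n) \<in> C"
      using X l by auto
    ultimately show ?thesis
      using C_closed(6)[of "\<phi> l" "\<lambda>n. \<phi> (X n)"] by simp
  qed
  have A_closed: "\<And>c x. x \<in> carrier A \<Longrightarrow> c \<odot>\<^bsub>A\<^esub> x \<in> carrier A"
    "\<And>x y. \<lbrakk>x \<in> carrier A; y \<in> carrier A\<rbrakk> \<Longrightarrow> x \<otimes>\<^bsub>A\<^esub> y \<in> carrier A"
    "\<And>x. x \<in> carrier A \<Longrightarrow> adj A x \<in> carrier A"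
    using carrier by (simp_all add: closed_star_subalgebra_def)
  have \<phi>_ops: "\<And>c x. x \<in> carrier A \<Longrightarrow> \<phi> (c \<odot>\<^bsub>A\<^esub> x) = c \<odot>\<^bsub>B\<^esub> \<phi> x"
    "\<And>x y. \<lbrakk>x \<in> carrier A; y \<in> carrier A\<rbrakk> \<Longrightarrow> \<phi> (x \<otimes>\<^bsub>A\<^esub> y) = \<phi> x \<otimes>\<^bsub>B\<^esub> \<phi> y"
    "\<And>x. x \<in> carrier A \<Longrightarrow> \<phi> (adj A x) = adj B (\<phi> x)"
    using \<phi> by (simp_all add: star_homs_def)
  show ?thesis
    unfolding closed_star_subalgebra_def
  proof (intro conjI allI ballI impI)
    fix X l
    assume "l \<in> carrier A" "\<forall>n::nat. X n \<in> {x \<in> carrier A. \<phi> x \<in> C}"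
      "(\<lambda>n. nrm A (X n \<ominus>\<^bsub>A\<^esub> l)) \<longlonglongrightarrow> 0"
    then show "l \<in> {x \<in> carrier A. \<phi> x \<in> C}"
      using limit[of l X] by simp
  qed (simp_all add: A_closed C_closed(1-5) \<phi>_ops subset_iff)
qed

lemma cstar_generated_simps:
  "monoid.mult (cstar_generated A X) = monoid.mult A"
  "add (cstar_generated A X) = add A"
  "smult (cstar_generated A X) = smult A"
  "adj (cstar_generated A X) = adj A"
  by (simp_all add: cstar_generated_def)

lemma mem_carrier_cstar_generated_iff:
  "x \<in> carrier (cstar_generated A X) \<longleftrightarrow> (\<forall>C. closed_star_subalgebra C A \<longrightarrow> X \<subseteq> C \<longrightarrow> x \<in> C)"
  by (auto simp: cstar_generated_def)

text \<open>
  The preimage of any closed *-subalgebra containing \<open>Y\<close> is one containing \<open>X\<close>.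
\<close>

lemma star_hom_maps_generated:
  assumes "abelian_group A" and "abelian_group B"
    and "closed_star_subalgebra (carrier A) A"
    and "\<phi> \<in> star_homs A B"
    and "\<And>x. x \<in> carrier A \<Longrightarrow> nrm B (\<phi> x) = nrm A x"
    and X: "X \<subseteq> carrier A" "\<phi> ` X \<subseteq> carrier (cstar_generated B Y)"
    and x: "x \<in> carrier (cstar_generated A X)"
  shows "\<phi> x \<in> carrier (cstar_generated B Y)"
  unfolding mem_carrier_cstar_generated_iff
proof (intro allI impI)
  fix C assume C: "closed_star_subalgebra C B" "Y \<subseteq> C"
  have "closed_star_subalgebra {x \<in> carrier A. \<phi> x \<in> C} A"
    using assms(1-5) C(1) by (rule closed_star_subalgebra_vimage)
  moreover have "X \<subseteq> {x \<in> carrier A. \<phi> x \<in> C}"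
    using X C unfolding image_subset_iff mem_carrier_cstar_generated_iff by blast
  ultimately show "\<phi> x \<in> C"
    using x unfolding mem_carrier_cstar_generated_iff by blast
qed

lemma carrier_cstar_generated_subset:
  assumes "closed_star_subalgebra (carrier A) A" and "X \<subseteq> carrier A"
  shows "carrier (cstar_generated A X) \<subseteq> carrier A"
  using assms unfolding subset_iff[of "carrier _"] mem_carrier_cstar_generated_iff by blast

lemma cstar_generated_isomorphic:
  assumes A: "abelian_group A" "closed_star_subalgebra (carrier A) A"
    and B: "abelian_group B" "closed_star_subalgebra (carrier B) B"
    and \<phi>: "\<phi> \<in> star_homs A B" "\<And>x. x \<in> carrier A \<Longrightarrow> nrm B (\<phi> x) = nrm A x"
    and \<psi>: "\<psi> \<in> star_homs B A" "\<And>y. y \<in> carrier B \<Longrightarrow> nrm A (\<psi> y) = nrm B y"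
    and inverse: "\<And>x. x \<in> carrier A \<Longrightarrow> \<psi> (\<phi> x) = x" "\<And>y. y \<in> carrier B \<Longrightarrow> \<phi> (\<psi> y) = y"
    and X: "X \<subseteq> carrier A" "\<phi> ` X \<subseteq> carrier (cstar_generated B Y)"
    and Y: "Y \<subseteq> carrier B" "\<psi> ` Y \<subseteq> carrier (cstar_generated A X)"
  shows "cstar_isomorphic (cstar_generated A X) (cstar_generated B Y)"
proof -
  let ?A = "carrier (cstar_generated A X)" and ?B = "carrier (cstar_generated B Y)"
  have sub: "?A \<subseteq> carrier A" "?B \<subseteq> carrier B"
    using A B X Y by (intro carrier_cstar_generated_subset; simp)+
  have \<phi>_maps: "\<phi> x \<in> ?B" if "x \<in> ?A" for x
    using A(1) B(1) A(2) \<phi> X that by (rule star_hom_maps_generated)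
  have \<psi>_maps: "\<psi> y \<in> ?A" if "y \<in> ?B" for y
    using B(1) A(1) B(2) \<psi> Y that by (rule star_hom_maps_generated)
  have "bij_betw \<phi> ?A ?B"
    by (rule bij_betw_byWitness[where f' = \<psi>]) (use sub \<phi>_maps \<psi>_maps inverse in auto)
  moreover have "\<phi> \<in> star_homs (cstar_generated A X) (cstar_generated B Y)"
    using \<phi>(1) \<phi>_maps subsetD[OF sub(1)] by (simp add: star_homs_def cstar_generated_simps)
  ultimately show ?thesis
    unfolding cstar_isomorphic_def by blast
qed

section \<open>Families of projections and partial isometries\<close>

lemma carrier_univ_proj:
  assumes "v \<in> verts G"
  shows "univ_proj G \<chi> v \<in> carrier (cstar_product (ck_indices G \<chi>) fst)"
proof (rule mem_carrier_cstar_productI[where K = 1])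
  fix i assume i: "i \<in> ck_indices G \<chi>"
  then interpret cstar_algebra "fst i" by (auto simp: ck_indices_def)
  have "is_projection (fst i) (univ_proj G \<chi> v i)"
    using assms i by (auto simp: univ_proj_def ck_indices_def ck_family_def)
  then show "univ_proj G \<chi> v i \<in> carrier (fst i)" "nrm (fst i) (univ_proj G \<chi> v i) \<le> 1"
    by (auto simp: is_projection_def nrm_projection_le_1)
qed (simp add: univ_proj_def)

lemma carrier_univ_pisom:
  assumes "wf_digraph G" and "e \<in> arcs G"
  shows "univ_pisom G \<chi> e \<in> carrier (cstar_product (ck_indices G \<chi>) fst)"
proof (rule mem_carrier_cstar_productI[where K = 1])
  fix i assume i: "i \<in> ck_indices G \<chi>"
  then interpret cstar_algebra "fst i" by (auto simp: ck_indices_def)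
  let ?s = "univ_pisom G \<chi> e i"
  show s: "?s \<in> carrier (fst i)"
    using assms i by (auto simp: univ_pisom_def ck_indices_def ck_family_def is_partial_isometry_def)
  have "is_projection (fst i) (adj (fst i) ?s \<otimes>\<^bsub>fst i\<^esub> ?s)"
    using assms i by (auto simp: univ_pisom_def ck_indices_def ck_family_def wf_digraph.tail_in_verts)
  then have "nrm (fst i) ?s ^ 2 \<le> 1"
    using s by (simp flip: cstar_identity add: nrm_projection_le_1)
  then show "nrm (fst i) ?s \<le> 1"
    by (simp add: power2_le_iff_abs_le abs_square_le_1 abs_le_iff)
qed (simp add: univ_pisom_def)

text \<open>
  The two graphs play equal roles: \<open>b\<close> and \<open>c\<close> are mutually inverse bijections of the edges that match \<open>e\<close>
  with \<open>e'\<close>, reverse this edge and only this one, and keep the other color classes together. The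
  numbering of the colors is immaterial.
\<close>

locale arc_reversal = G: wf_digraph G + H: wf_digraph H
  for G :: "('v, 'e) pre_digraph" and \<chi> :: "'e \<Rightarrow> nat" and e :: 'e
    and H :: "('v, 'f) pre_digraph" and \<psi> :: "'f \<Rightarrow> nat" and e' :: 'f
    and b :: "'e \<Rightarrow> 'f" and c :: "'f \<Rightarrow> 'e" +
  assumes verts: "verts H = verts G"
    and arcs: "e \<in> arcs G" "e' \<in> arcs H"
    and b_arcs: "f \<in> arcs G \<Longrightarrow> b f \<in> arcs H" and c_arcs: "h \<in> arcs H \<Longrightarrow> c h \<in> arcs G"
    and c_b: "f \<in> arcs G \<Longrightarrow> c (b f) = f" and b_c: "h \<in> arcs H \<Longrightarrow> b (c h) = h"
    and b_e: "b e = e'"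
    and tail_b: "\<lbrakk>f \<in> arcs G; f \<noteq> e\<rbrakk> \<Longrightarrow> tail H (b f) = tail G f"
    and head_b: "\<lbrakk>f \<in> arcs G; f \<noteq> e\<rbrakk> \<Longrightarrow> head H (b f) = head G f"
    and tail_e': "tail H e' = head G e" and head_e': "head H e' = tail G e"
    and color_b: "\<lbrakk>f \<in> arcs G; f \<noteq> e; g \<in> arcs G; g \<noteq> e\<rbrakk> \<Longrightarrow> \<psi> (b f) = \<psi> (b g) \<longleftrightarrow> \<chi> f = \<chi> g"
    and color_e: "\<lbrakk>g \<in> arcs G; g \<noteq> e; head G g = head G e\<rbrakk> \<Longrightarrow> \<chi> e \<noteq> \<chi> g"
    and color_e': "\<lbrakk>h \<in> arcs H; h \<noteq> e'; head H h = head H e'\<rbrakk> \<Longrightarrow> \<psi> e' \<noteq> \<psi> h"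
begin

lemma c_e': "c e' = e"
  using c_b[OF arcs(1)] by (simp add: b_e)

lemma c_eq_e_iff: "h \<in> arcs H \<Longrightarrow> c h = e \<longleftrightarrow> h = e'"
  using b_c b_e c_e' by metis

lemma b_eq_e'_iff: "f \<in> arcs G \<Longrightarrow> b f = e' \<longleftrightarrow> f = e"
  using c_b b_e c_e' by metis

lemma tail_c: "\<lbrakk>h \<in> arcs H; h \<noteq> e'\<rbrakk> \<Longrightarrow> tail G (c h) = tail H h"
  using tail_b[of "c h"] by (simp add: c_arcs b_c c_eq_e_iff)

lemma head_c: "\<lbrakk>h \<in> arcs H; h \<noteq> e'\<rbrakk> \<Longrightarrow> head G (c h) = head H h"
  using head_b[of "c h"] by (simp add: c_arcs b_c c_eq_e_iff)

lemma color_c: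
  "\<lbrakk>h \<in> arcs H; h \<noteq> e'; k \<in> arcs H; k \<noteq> e'\<rbrakk> \<Longrightarrow> \<chi> (c h) = \<chi> (c k) \<longleftrightarrow> \<psi> h = \<psi> k"
  using color_b[of "c h" "c k"] by (simp add: c_arcs b_c c_eq_e_iff)

lemma arc_reversal_sym: "arc_reversal H \<psi> e' G \<chi> e c b"
proof -
  have "arc_reversal_axioms H \<psi> e' G \<chi> e c b"
    by unfold_locales
      (use verts arcs c_e' color_e color_e' tail_e' head_e' in
        \<open>auto simp: b_arcs c_arcs c_b b_c tail_c head_c color_c\<close>)
  then show ?thesis
    by (intro arc_reversal.intro G.wf_digraph_axioms H.wf_digraph_axioms)
qed

definition reversed :: "('a, 'm) cstar_scheme \<Rightarrow> ('e \<Rightarrow> 'a) \<Rightarrow> 'f \<Rightarrow> 'a" where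
  "reversed A S = (\<lambda>h\<in>arcs H. if h = e' then adj A (S e) else S (c h))"

text \<open>
  A nonempty color class of \<open>H\<close> other than \<open>{e'}\<close> is the image under \<open>b\<close> of a color class of \<open>G\<close>, with the
  same operators. For the class \<open>{e'}\<close> the relation reads \<open>S\<^sub>e* S\<^sub>e = p\<^bsub>s(e)\<^esub>\<close>, while the relation of the
  class \<open>{e}\<close> gives what is required of the initial projection of the new partial isometry.
\<close>

lemma ck_family_reversed:
  assumes A: "cstar_algebra A" and family: "ck_family G \<chi> A p S"
  shows "ck_family H \<psi> A p (reversed A S)"
proof -
  interpret A: cstar_algebra A by fact
  let ?T = "reversed A S"
  have proj: "is_projection A (p v)" if "v \<in> verts G" for v
    using family that by (simp add: ck_family_def)
  have isom: "is_partial_isometry A (S f)" if "f \<in> arcs G" for f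
    using family that by (simp add: ck_family_def)
  then have S_closed: "S f \<in> carrier A" if "f \<in> arcs G" for f
    using that by (auto simp: is_partial_isometry_def)
  have initial: "adj A (S f) \<otimes>\<^bsub>A\<^esub> S f = p (tail G f)" if "f \<in> arcs G" for f
    using family that by (simp add: ck_family_def)
  have range: "(\<forall>F. finite F \<and> F \<subseteq> X \<longrightarrow> cstar_le A (\<Oplus>\<^bsub>A\<^esub>f\<in>F. S f \<otimes>\<^bsub>A\<^esub> adj A (S f)) (p v)) \<and>
      (finite X \<longrightarrow> (\<Oplus>\<^bsub>A\<^esub>f\<in>X. S f \<otimes>\<^bsub>A\<^esub> adj A (S f)) = p v)"
    if "v \<in> verts G" "X = {f \<in> arcs G. head G f = v \<and> \<chi> f = i}" "X \<noteq> {}" for v i X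
    using family that by (simp add: ck_family_def Let_def)
  have "{f \<in> arcs G. head G f = head G e \<and> \<chi> f = \<chi> e} = {e}"
    using color_e arcs(1) by fastforce
  then have final_e: "S e \<otimes>\<^bsub>A\<^esub> adj A (S e) = p (head G e)"
    using range[of "head G e" "{e}" "\<chi> e"] arcs(1) S_closed[OF arcs(1)]
    by (auto simp: A.mult_closed A.adj_closed)
  have T_e': "?T e' = adj A (S e)"
    using arcs(2) by (simp add: reversed_def)
  have T_b: "?T (b f) = S f" if "f \<in> arcs G" "f \<noteq> e" for f
    using that by (simp add: reversed_def b_arcs c_b b_eq_e'_iff)
  have T_closed: "?T h \<in> carrier A" if "h \<in> arcs H" for h
    using that S_closed c_arcs arcs(1) by (simp add: reversed_def A.adj_closed)
  have "(\<forall>F. finite F \<and> F \<subseteq> X \<longrightarrow> cstar_le A (\<Oplus>\<^bsub>A\<^esub>h\<in>F. ?T h \<otimes>\<^bsub>A\<^esub> adj A (?T h)) (p v)) \<and>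
      (finite X \<longrightarrow> (\<Oplus>\<^bsub>A\<^esub>h\<in>X. ?T h \<otimes>\<^bsub>A\<^esub> adj A (?T h)) = p v)"
    if v: "v \<in> verts H" and X: "X = {h \<in> arcs H. head H h = v \<and> \<psi> h = i}" and "X \<noteq> {}" for v i X
  proof (cases "e' \<in> X")
    case True
    then have X_e': "X = {e'}" and v_e: "v = tail G e"
      using color_e' head_e' unfolding X by fastforce+
    have pv: "is_projection A (p v)"
      using proj v verts by simp
    then have pv_closed: "p v \<in> carrier A"
      by (simp add: is_projection_def)
    have "?T e' \<otimes>\<^bsub>A\<^esub> adj A (?T e') = p v"
      using initial arcs(1) S_closed by (simp add: T_e' A.adj_adj v_e)
    then have sum: "(\<Oplus>\<^bsub>A\<^esub>h\<in>{e'}. ?T h \<otimes>\<^bsub>A\<^esub> adj A (?T h)) = p v"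
      using pv_closed T_closed[OF arcs(2)] by simp
    have "cstar_le A (\<Oplus>\<^bsub>A\<^esub>h\<in>F. ?T h \<otimes>\<^bsub>A\<^esub> adj A (?T h)) (p v)" if "F \<subseteq> X" for F
    proof -
      \<comment> \<open>The inequality is \<open>0 \<le> p v\<close> in the one case and \<open>p v \<le> p v\<close> in the other.\<close>
      have "F = {} \<or> F = {e'}"
        using that X_e' by blast
      then show ?thesis
        using pv pv_closed sum by (auto simp only: A.finsum_empty A.cstar_le_zero_projection A.cstar_le_refl)
    qed
    then show ?thesis
      using sum X_e' by simp
  next
    case False
    obtain h where h: "h \<in> X"
      using \<open>X \<noteq> {}\<close> by blast
    have hH: "h \<in> arcs H" "h \<noteq> e'" "head H h = v" "\<psi> h = i"
      using h False unfolding X by auto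
    define Y where "Y = {f \<in> arcs G. head G f = v \<and> \<chi> f = \<chi> (c h)}"
    have cY: "c k \<in> Y" if "k \<in> X" for k
    proof -
      have "k \<in> arcs H" "k \<noteq> e'" "head H k = v" "\<psi> k = \<psi> h"
        using that False hH X by auto
      then show ?thesis
        using hH by (simp add: Y_def c_arcs head_c color_c)
    qed
    \<comment> \<open>Otherwise \<open>c h\<close> would have the same range and color as \<open>e\<close>.\<close>
    have e_Y: "e \<notin> Y"
    proof
      assume "e \<in> Y"
      then have "head G (c h) = head G e" "\<chi> e = \<chi> (c h)"
        using hH by (auto simp: Y_def head_c)
      then show False
        using color_e[of "c h"] hH by (simp add: c_arcs c_eq_e_iff)
    qed
    have bY: "b f \<in> X" if "f \<in> Y" for f
    proof -
      have f: "f \<in> arcs G" "f \<noteq> e" "head G f = v" "\<chi> f = \<chi> (c h)"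
        using that e_Y by (auto simp: Y_def)
      then have "\<psi> (b f) = \<psi> h"
        using color_b[of f "c h"] hH by (simp add: c_arcs c_eq_e_iff b_c)
      then show ?thesis
        using f hH by (simp add: X b_arcs head_b)
    qed
    have XH: "X \<subseteq> arcs H" and YG: "Y \<subseteq> arcs G"
      by (auto simp: X Y_def)
    have sum: "(\<Oplus>\<^bsub>A\<^esub>h\<in>F. ?T h \<otimes>\<^bsub>A\<^esub> adj A (?T h)) = (\<Oplus>\<^bsub>A\<^esub>f\<in>c ` F. S f \<otimes>\<^bsub>A\<^esub> adj A (S f))"
      if F: "F \<subseteq> X" for F
    proof -
      have closed: "?T k \<otimes>\<^bsub>A\<^esub> adj A (?T k) \<in> carrier A" if "k \<in> F" for k
        using that F XH T_closed by (auto intro!: A.mult_closed A.adj_closed)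
      have eq: "?T k = S (c k)" if "k \<in> F" for k
        using that F XH False by (auto simp: reversed_def)
      have "inj_on c F"
        using F XH b_c by (metis inj_onI subsetD)
      then have "(\<Oplus>\<^bsub>A\<^esub>f\<in>c ` F. S f \<otimes>\<^bsub>A\<^esub> adj A (S f)) = (\<Oplus>\<^bsub>A\<^esub>h\<in>F. S (c h) \<otimes>\<^bsub>A\<^esub> adj A (S (c h)))"
        using closed eq by (intro A.finsum_reindex) auto
      also have "\<dots> = (\<Oplus>\<^bsub>A\<^esub>h\<in>F. ?T h \<otimes>\<^bsub>A\<^esub> adj A (?T h))"
        using closed by (intro A.finsum_cong') (auto simp: eq)
      finally show ?thesis by simp
    qed
    have cX: "c ` X = Y"
    proof (intro equalityI subsetI)
      fix f assume "f \<in> Y"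
      then show "f \<in> c ` X"
        using bY YG c_b by (metis image_eqI subsetD)
    qed (use cY in auto)
    have "Y \<noteq> {}"
      using cX h by blast
    note range_Y = range[OF v[unfolded verts] Y_def this]
    show ?thesis
    proof (intro conjI allI impI)
      fix F assume F: "finite F \<and> F \<subseteq> X"
      then have "finite (c ` F) \<and> c ` F \<subseteq> Y"
        using cX by blast
      then show "cstar_le A (\<Oplus>\<^bsub>A\<^esub>h\<in>F. ?T h \<otimes>\<^bsub>A\<^esub> adj A (?T h)) (p v)"
        using range_Y sum[of F] F by simp
    next
      assume "finite X"
      then show "(\<Oplus>\<^bsub>A\<^esub>h\<in>X. ?T h \<otimes>\<^bsub>A\<^esub> adj A (?T h)) = p v"
        using range_Y sum[OF subset_refl] cX by (metis finite_imageI)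
    qed
  qed
  moreover have "is_partial_isometry A (?T h)" if "h \<in> arcs H" for h
    using that isom arcs(1) by (simp add: reversed_def c_arcs A.is_partial_isometry_adj)
  moreover have "adj A (?T h) \<otimes>\<^bsub>A\<^esub> ?T h = p (tail H h)" if "h \<in> arcs H" for h
    using that initial final_e S_closed[OF arcs(1)]
    by (simp add: reversed_def c_arcs A.adj_adj tail_e' tail_c)
  ultimately show ?thesis
    using family verts by (auto simp: ck_family_def Let_def reversed_def)
qed

definition reversed_index :: "('v, 'e) ck_index \<Rightarrow> ('v, 'f) ck_index" where
  "reversed_index = (\<lambda>(A, p, S). (A, p, reversed A S))"

lemma reversed_index_closed: "i \<in> ck_indices G \<chi> \<Longrightarrow> reversed_index i \<in> ck_indices H \<psi>"
  by (auto simp: ck_indices_def reversed_index_def ck_family_reversed)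

lemma fst_reversed_index: "fst (reversed_index i) = fst i"
  by (simp add: reversed_index_def split: prod.split)

abbreviation generators_G :: "(('v, 'e) ck_index \<Rightarrow> nat set) set" where
  "generators_G \<equiv> univ_proj G \<chi> ` verts G \<union> univ_pisom G \<chi> ` arcs G"

abbreviation generators_H :: "(('v, 'f) ck_index \<Rightarrow> nat set) set" where
  "generators_H \<equiv> univ_proj H \<psi> ` verts H \<union> univ_pisom H \<psi> ` arcs H"

text \<open>
  At the index \<open>(A, p, S)\<close> the pullback of \<open>x\<close> is the image of \<open>x\<close> under the canonical *-homomorphism of the
  reversed family.
\<close>

definition pullback :: "(('v, 'f) ck_index \<Rightarrow> nat set) \<Rightarrow> ('v, 'e) ck_index \<Rightarrow> nat set" where
  "pullback x = (\<lambda>i\<in>ck_indices G \<chi>. x (reversed_index i))"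

lemma pullback_univ_proj: "pullback (univ_proj H \<psi> v) = univ_proj G \<chi> v"
  by (auto simp: pullback_def univ_proj_def fun_eq_iff reversed_index_closed)
    (auto simp: reversed_index_def split: prod.split)

lemma pullback_univ_pisom:
  assumes "h \<in> arcs H"
  shows "pullback (univ_pisom H \<psi> h) =
    (if h = e' then adj (cstar_product (ck_indices G \<chi>) fst) (univ_pisom G \<chi> e)
     else univ_pisom G \<chi> (c h))"
  using assms
  by (auto simp: pullback_def univ_pisom_def fun_eq_iff reversed_index_closed cstar_product_simps)
    (auto simp: reversed_index_def reversed_def split: prod.split)

lemma pullback_generators:
  "pullback ` generators_H \<subseteq> carrier (cstar_generated (cstar_product (ck_indices G \<chi>) fst) generators_G)"
  unfolding image_subset_iff mem_carrier_cstar_generated_iff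
proof (intro ballI allI impI)
  fix x C
  assume x: "x \<in> generators_H"
    and C: "closed_star_subalgebra C (cstar_product (ck_indices G \<chi>) fst)" "generators_G \<subseteq> C"
  have proj: "univ_proj G \<chi> v \<in> C" if "v \<in> verts G" for v
    using that C(2) by blast
  have pisom: "univ_pisom G \<chi> f \<in> C" if "f \<in> arcs G" for f
    using that C(2) by blast
  have adj: "adj (cstar_product (ck_indices G \<chi>) fst) y \<in> C" if "y \<in> C" for y
    using that C(1) by (simp add: closed_star_subalgebra_def)
  from x consider v where "x = univ_proj H \<psi> v" "v \<in> verts H"
    | h where "x = univ_pisom H \<psi> h" "h \<in> arcs H"
    by blast
  then show "pullback x \<in> C"
  proof cases
    case 1
    then show ?thesis
      using proj verts by (simp add: pullback_univ_proj)
  next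
    case 2
    then show ?thesis
      using adj[OF pisom[OF arcs(1)]] pisom[OF c_arcs] by (simp add: pullback_univ_pisom)
  qed
qed

lemma generators_G_carrier: "generators_G \<subseteq> carrier (cstar_product (ck_indices G \<chi>) fst)"
  by (auto simp: carrier_univ_proj carrier_univ_pisom[OF G.wf_digraph_axioms])

end

context arc_reversal
begin

interpretation sym: arc_reversal H \<psi> e' G \<chi> e c b
  by (rule arc_reversal_sym)

lemma reversed_index_inverse:
  assumes "i \<in> ck_indices G \<chi>"
  shows "sym.reversed_index (reversed_index i) = i"
proof -
  obtain A p S where i: "i = (A, p, S)" and A: "cstar_algebra A" and family: "ck_family G \<chi> A p S"
    using assms by (auto simp: ck_indices_def)
  interpret A: cstar_algebra A by fact
  have S: "S \<in> extensional (arcs G)" "S e \<in> carrier A"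
    using family arcs(1) by (auto simp: ck_family_def is_partial_isometry_def)
  have "sym.reversed A (reversed A S) = S"
  proof
    fix f
    show "sym.reversed A (reversed A S) f = S f"
      using S arcs by (auto simp: sym.reversed_def reversed_def extensional_def A.adj_adj b_arcs c_b b_eq_e'_iff)
  qed
  then show ?thesis
    by (simp add: i reversed_index_def sym.reversed_index_def)
qed

end

context arc_reversal
begin

interpretation sym: arc_reversal H \<psi> e' G \<chi> e c b
  by (rule arc_reversal_sym)

lemma reversed_index_image: "reversed_index ` ck_indices G \<chi> = ck_indices H \<psi>"
proof (intro equalityI subsetI)
  fix j assume "j \<in> ck_indices H \<psi>"
  then show "j \<in> reversed_index ` ck_indices G \<chi>"
    by (intro image_eqI[where x = "sym.reversed_index j"])
      (simp_all only: sym.reversed_index_closed sym.reversed_index_inverse)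
qed (auto simp: reversed_index_closed)

lemma pullback_star_homs:
  "pullback \<in> star_homs (cstar_product (ck_indices H \<psi>) fst) (cstar_product (ck_indices G \<chi>) fst)"
  unfolding pullback_def[abs_def]
  by (rule pullback_star_hom) (auto simp: reversed_index_closed fst_reversed_index)

lemma nrm_pullback_eq:
  "nrm (cstar_product (ck_indices G \<chi>) fst) (pullback x) = nrm (cstar_product (ck_indices H \<psi>) fst) x"
  unfolding pullback_def by (rule nrm_pullback) (auto simp: reversed_index_image fst_reversed_index)

lemma pullback_inverse:
  assumes "x \<in> carrier (cstar_product (ck_indices G \<chi>) fst)"
  shows "pullback (sym.pullback x) = x"
proof
  have x: "x \<in> extensional (ck_indices G \<chi>)"
    using assms by (auto elim: mem_carrier_cstar_productE)
  show "pullback (sym.pullback x) i = x i" for i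
    using extensional_arb[OF x, of i]
    by (cases "i \<in> ck_indices G \<chi>")
      (simp_all add: pullback_def sym.pullback_def reversed_index_closed reversed_index_inverse)
qed

end

theorem (in arc_reversal) graph_cstar_isomorphic:
  "cstar_isomorphic (graph_cstar G \<chi>) (graph_cstar H \<psi>)"
proof -
  interpret sym: arc_reversal H \<psi> e' G \<chi> e c b by (rule arc_reversal_sym)
  have "cstar_algebra (fst i)" if "i \<in> ck_indices G \<chi>" for i
    using that by (auto simp: ck_indices_def)
  note productG = abelian_group_cstar_product[of "ck_indices G \<chi>" fst, OF this]
    closed_star_subalgebra_carrier_cstar_product[of "ck_indices G \<chi>" fst, OF this]
  have "cstar_algebra (fst i)" if "i \<in> ck_indices H \<psi>" for i
    using that by (auto simp: ck_indices_def)
  note productH = abelian_group_cstar_product[of "ck_indices H \<psi>" fst, OF this]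
    closed_star_subalgebra_carrier_cstar_product[of "ck_indices H \<psi>" fst, OF this]
  show ?thesis
    unfolding graph_cstar_def
    by (rule cstar_generated_isomorphic[where \<phi> = sym.pullback and \<psi> = pullback])
      (simp_all only: productG productH pullback_star_homs sym.pullback_star_homs nrm_pullback_eq
        sym.nrm_pullback_eq pullback_inverse sym.pullback_inverse generators_G_carrier
        sym.generators_G_carrier pullback_generators sym.pullback_generators)
qed

section \<open>Reversing an edge\<close>

text \<open>
  Colors start at 1, so after the shift by 1 the color of the reversed edge is not used by any other edge.
\<close>

lemma arc_reversal_reverse_arc:
  assumes "edge_colored_digraph G \<chi>" and e: "e \<in> arcs G"
    and isolated: "\<And>g. \<lbrakk>g \<in> arcs G; g \<noteq> e; head G g = head G e\<rbrakk> \<Longrightarrow> \<chi> e \<noteq> \<chi> g"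
  shows "arc_reversal G \<chi> e (reverse_arc G e) (reverse_coloring \<chi>) Bar
    (\<lambda>f. if f = e then Bar else Old f) (case_rev_arc (\<lambda>f. f) e)"
proof -
  interpret edge_colored_digraph G \<chi> by fact
  have color_0: "f \<notin> arcs G" if "\<chi> f = 0" for f
    using color_pos[of f] that by auto
  show ?thesis
    using e isolated
    by unfold_locales
      (auto simp: reverse_arc_def reverse_coloring_def dest: color_0 split: rev_arc.splits)
qed

theorem proposition3:
  fixes G :: "('v, 'e) pre_digraph" and \<chi> :: "'e \<Rightarrow> nat" and e :: 'e
  assumes "edge_colored_digraph G \<chi>"
    and "e \<in> arcs G"
    and "\<And>g. \<lbrakk>g \<in> arcs G; g \<noteq> e; head G g = head G e\<rbrakk> \<Longrightarrow> \<chi> e \<noteq> \<chi> g"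
  shows "cstar_isomorphic (graph_cstar G \<chi>) (graph_cstar (reverse_arc G e) (reverse_coloring \<chi>))"
  using assms by (rule arc_reversal.graph_cstar_isomorphic[OF arc_reversal_reverse_arc])

end
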